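(* Let $T,N\in\mathbb{Z}_{>0}$, $L\in\mathbb{Z}_{\ge 0}$, $U>0$, let $\mathcal{D}=\mathcal{D}^1\times\cdots\times\mathcal{D}^{T+L}$ be a product probability distribution on $[0,U]^{T+L}$ (demands independent across time), and let $\Pi$ be a policy class with loss functions $\ell(\pi,\cdot):[0,U]^{T+L}\to\mathbb{R}$, $\pi\in\Pi$. Then $$\mathbb{E}_{\mathbf{d}_1,\dots,\mathbf{d}_N\sim\mathcal{D}}\big[\mathrm{EE}^{\times}(\mathcal{L}(\Pi))\big]\le\mathbb{E}_{\mathbf{d}_1,\dots,\mathbf{d}_N\sim\mathcal{D}}\big[\mathrm{GE}^{\times}(\mathcal{L}(\Pi))\big]\le\mathbb{E}_{\mathbf{d}_1,\dots,\mathbf{d}_N\sim\mathcal{D}}\big[\mathrm{GE}(\mathcal{L}(\Pi))\big].$$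
   Context: $\mathbf{d}_i=(d_i^t)_{t=1}^{T+L}$, $i=1,\dots,N$, are i.i.d. samples from $\mathcal{D}$. $\mathcal{L}(\Pi)=\{\ell(\pi,\cdot):\pi\in\Pi\}$, where $\ell(\pi,\mathbf{d})$ is the (bounded) average loss of policy $\pi$ on demand sequence $\mathbf{d}$. $R(\pi)=\mathbb{E}_{\mathbf{d}\sim\mathcal{D}}[\ell(\pi,\mathbf{d})]$, $\hat R(\pi)=\frac1N\sum_{i=1}^N\ell(\pi,\mathbf{d}_i)$, and $\mathrm{GE}(\mathcal{L}(\Pi))=\sup_{\pi\in\Pi}\{R(\pi)-\hat R(\pi)\}$. Product empirical risk minimization (PERM): for $\mathbf{i}=(i_1,\dots,i_{T+L})\in\{1,\dots,N\}^{T+L}$ let $\mathbf{d}^{\times}_{\mathbf{i}}=(d^1_{i_1},\dots,d^{T+L}_{i_{T+L}})$, and let $R^{\times}(\pi)=\frac{1}{N^{T+L}}\sum_{\mathbf{i}\in\{1,\dots,N\}^{T+L}}\ell(\pi,\mathbf{d}^{\times}_{\mathbf{i}})$. Let $\pi^{\times}\in\arg\inf_{\pi\in\Pi}R^{\times}(\pi)$ and $\pi^*\in\arg\inf_{\pi\in\Pi}R(\pi)$ (minimizers presumed to exist). Define $\mathrm{EE}^{\times}(\mathcal{L}(\Pi))=R(\pi^{\times})-R(\pi^* )$ and $\mathrm{GE}^{\times}(\mathcal{L}(\Pi))=\sup_{\pi\in\Pi}\{R(\pi)-R^{\times}(\pi)\}$. *)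

theory Defs
  imports "HOL-Probability.Probability"
begin

text \<open>
  A demand sequence of length \<open>n\<close> is an element of \<open>{1..n} \<rightarrow>\<^sub>E {0..U}\<close>, the underlying space
  of a finite product of measures on \<open>{0..U}\<close>; a sample \<open>ds\<close> assigns to each \<open>i \<in> {1..N}\<close> a
  demand sequence \<open>ds i\<close>. A loss is a function \<open>l\<close> taking a policy and a demand sequence.
\<close>

type_synonym demand_seq = "nat \<Rightarrow> real"

definition demand_dist :: "nat \<Rightarrow> (nat \<Rightarrow> real measure) \<Rightarrow> demand_seq measure" where
  "demand_dist n Dt = (\<Pi>\<^sub>M t\<in>{1..n}. Dt t)"

definition sample_dist :: "nat \<Rightarrow> demand_seq measure \<Rightarrow> (nat \<Rightarrow> demand_seq) measure" where
  "sample_dist N D = (\<Pi>\<^sub>M i\<in>{1..N}. D)"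

definition risk :: "demand_seq measure \<Rightarrow> ('p \<Rightarrow> demand_seq \<Rightarrow> real) \<Rightarrow> 'p \<Rightarrow> real" where
  "risk D l \<pi> = (\<integral>d. l \<pi> d \<partial>D)"

definition emp_risk ::
  "nat \<Rightarrow> ('p \<Rightarrow> demand_seq \<Rightarrow> real) \<Rightarrow> (nat \<Rightarrow> demand_seq) \<Rightarrow> 'p \<Rightarrow> real" where
  "emp_risk N l ds \<pi> = (1 / real N) * (\<Sum>i=1..N. l \<pi> (ds i))"

definition product_seq ::
  "nat \<Rightarrow> (nat \<Rightarrow> demand_seq) \<Rightarrow> (nat \<Rightarrow> nat) \<Rightarrow> demand_seq" where
  "product_seq n ds idx = (\<lambda>t\<in>{1..n}. ds (idx t) t)"

definition product_risk ::
  "nat \<Rightarrow> nat \<Rightarrow> ('p \<Rightarrow> demand_seq \<Rightarrow> real) \<Rightarrow> (nat \<Rightarrow> demand_seq) \<Rightarrow> 'p \<Rightarrow> real" where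
  "product_risk n N l ds \<pi> =
     (1 / real N ^ n) * (\<Sum>idx \<in> {1..n} \<rightarrow>\<^sub>E {1..N}. l \<pi> (product_seq n ds idx))"

text \<open>
  The suprema below are taken in the reals, hence are meaningful only for bounded losses.
\<close>

definition gen_error ::
  "nat \<Rightarrow> demand_seq measure \<Rightarrow> ('p \<Rightarrow> demand_seq \<Rightarrow> real) \<Rightarrow> 'p set
    \<Rightarrow> (nat \<Rightarrow> demand_seq) \<Rightarrow> real" where
  "gen_error N D l P ds = (SUP \<pi>\<in>P. risk D l \<pi> - emp_risk N l ds \<pi>)"

definition product_gen_error ::
  "nat \<Rightarrow> nat \<Rightarrow> demand_seq measure \<Rightarrow> ('p \<Rightarrow> demand_seq \<Rightarrow> real) \<Rightarrow> 'p set
    \<Rightarrow> (nat \<Rightarrow> demand_seq) \<Rightarrow> real" where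
  "product_gen_error n N D l P ds = (SUP \<pi>\<in>P. risk D l \<pi> - product_risk n N l ds \<pi>)"

text \<open>
  The excess risk of the policy \<open>perm ds\<close> chosen from the sample \<open>ds\<close>, relative to \<open>opt\<close>.
\<close>

definition est_error ::
  "demand_seq measure \<Rightarrow> ('p \<Rightarrow> demand_seq \<Rightarrow> real) \<Rightarrow> ((nat \<Rightarrow> demand_seq) \<Rightarrow> 'p) \<Rightarrow> 'p
    \<Rightarrow> (nat \<Rightarrow> demand_seq) \<Rightarrow> real" where
  "est_error D l perm opt ds = risk D l (perm ds) - risk D l opt"

end

theory Submission imports Defs begin

text \<open>
  Index tuples \<open>k \<in> {1..N}\<^sup>n\<close> also label recombinations of the whole sample: shift the \<open>t\<close>-th
  coordinates of the \<open>N\<close> demand sequences cyclically by \<open>k t\<close>. Each recombined sample has the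
  law of the original one, because the coordinates are independent, and the product risk is the
  average over \<open>k\<close> of the empirical risks of the recombined samples. As the supremum of an average
  is at most the average of the suprema, the product generalization error is at most, in
  expectation, the generalization error. The bound on the estimation error follows since the
  product risk of the fixed policy \<open>\<pi>_opt\<close> is an unbiased estimate of its risk.
\<close>

section \<open>Regrouping and relabelling coordinates of iterated product measures\<close>

text \<open>The coordinates of the flat product over \<open>I \<times> J\<close> are independent, so
  the disjoint blocks \<open>{i} \<times> J\<close> are independent too, and each block has law
  \<open>PiM J M\<close>. Claims about samples thereby reduce to reindexings of one flat
  product.\<close>

lemma distr_PiM_curry:
  fixes M :: "'t \<Rightarrow> 'a measure" and I :: "'i set" and J :: "'t set"
  assumes M: "\<And>t. t \<in> J \<Longrightarrow> prob_space (M t)" and ne: "I \<noteq> {}" "J \<noteq> {}"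
  shows "distr (\<Pi>\<^sub>M p\<in>I \<times> J. M (snd p)) (\<Pi>\<^sub>M i\<in>I. \<Pi>\<^sub>M t\<in>J. M t) (\<lambda>f. \<lambda>i\<in>I. \<lambda>t\<in>J. f (i, t))
    = (\<Pi>\<^sub>M i\<in>I. \<Pi>\<^sub>M t\<in>J. M t)"
proof -
  let ?M = "\<lambda>p :: 'i \<times> 't. M (snd p)"
  let ?F = "PiM (I \<times> J) ?M"
  have M': "prob_space (?M p)" if "p \<in> I \<times> J" for p
    using that M by auto
  interpret F: prob_space ?F
    by (intro prob_space_PiM M')
  \<comment> \<open>Reindexing along the identity puts the joint law of the coordinates in the form
    required by the criterion that a family is independent iff its joint law is the product of its
    marginal laws.\<close>
  have "distr ?F ?F (\<lambda>f. \<lambda>p\<in>I \<times> J. f p) = ?F"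
    using distr_PiM_reindex[of "I \<times> J" ?M "\<lambda>p. p" "I \<times> J"] M' by auto
  moreover have "distr ?F (?M p) (\<lambda>f. f p) = ?M p" if "p \<in> I \<times> J" for p
    using that by (intro distr_PiM_component M')
  then have "(\<Pi>\<^sub>M p\<in>I \<times> J. distr ?F (?M p) (\<lambda>f. f p)) = ?F"
    by (intro PiM_cong) auto
  ultimately have "F.indep_vars ?M (\<lambda>p f. f p) (I \<times> J)"
    using ne by (subst F.indep_vars_iff_distr_eq_PiM') auto
  then have "F.indep_vars (\<lambda>i. PiM ({i} \<times> J) ?M) (\<lambda>i f. \<lambda>p\<in>{i} \<times> J. f p) I"
    by (rule F.indep_vars_restrict) (auto simp: disjoint_family_on_def)
  then have "F.indep_vars (\<lambda>i. PiM J M) (\<lambda>i f. \<lambda>t\<in>J. (\<lambda>p\<in>{i} \<times> J. f p) (i, t)) I"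
  proof (rule F.indep_vars_compose2)
    show "(\<lambda>f. \<lambda>t\<in>J. f (i, t)) \<in> PiM ({i} \<times> J) ?M \<rightarrow>\<^sub>M PiM J M" for i
    proof (rule measurable_restrict)
      show "(\<lambda>f. f (i, t)) \<in> PiM ({i} \<times> J) ?M \<rightarrow>\<^sub>M M t" if "t \<in> J" for t
        using measurable_component_singleton[of "(i, t)" "{i} \<times> J" ?M] that by simp
    qed
  qed
  then have indep: "F.indep_vars (\<lambda>i. PiM J M) (\<lambda>i f. \<lambda>t\<in>J. f (i, t)) I"
    by (simp cong: restrict_cong)
  have meas: "(\<lambda>f. \<lambda>t\<in>J. f (i, t)) \<in> ?F \<rightarrow>\<^sub>M PiM J M" if "i \<in> I" for i
  proof (rule measurable_restrict)
    show "(\<lambda>f. f (i, t)) \<in> ?F \<rightarrow>\<^sub>M M t" if "t \<in> J" for t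
      using measurable_component_singleton[of "(i, t)" "I \<times> J" ?M] that \<open>i \<in> I\<close> by simp
  qed
  have block: "distr ?F (PiM J M) (\<lambda>f. \<lambda>t\<in>J. f (i, t)) = PiM J M" if "i \<in> I" for i
    using distr_PiM_reindex[of "I \<times> J" ?M "\<lambda>t. (i, t)" J] M' that
    by (auto simp: inj_on_def)
  \<comment> \<open>The same criterion for the blocks, now from independence to the joint
    law.\<close>
  have "distr ?F (\<Pi>\<^sub>M i\<in>I. PiM J M) (\<lambda>f. \<lambda>i\<in>I. \<lambda>t\<in>J. f (i, t))
    = (\<Pi>\<^sub>M i\<in>I. distr ?F (PiM J M) (\<lambda>f. \<lambda>t\<in>J. f (i, t)))"
    using indep ne meas by (subst (asm) F.indep_vars_iff_distr_eq_PiM') auto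
  also have "\<dots> = (\<Pi>\<^sub>M i\<in>I. PiM J M)"
    using block by (intro PiM_cong) auto
  finally show ?thesis .
qed

lemma measurable_PiM_PiM_component:
  assumes "i \<in> I" "t \<in> J"
  shows "(\<lambda>x. x i t) \<in> (\<Pi>\<^sub>M i\<in>I. \<Pi>\<^sub>M t\<in>J. M t) \<rightarrow>\<^sub>M M t"
  using measurable_component_singleton[OF assms(1)] measurable_component_singleton[OF assms(2)]
  by (rule measurable_compose)

text \<open>The cells \<open>(g t, t)\<close> are distinct for distinct \<open>t\<close> even if
  \<open>g\<close> repeats indices, so on the flat product this is an injective reindexing. It gives
  every recombined demand sequence the law of an original one.\<close>

lemma distr_PiM_PiM_pick:
  fixes M :: "'t \<Rightarrow> 'a measure" and I :: "'i set" and J :: "'t set"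
  assumes M: "\<And>t. t \<in> J \<Longrightarrow> prob_space (M t)" and ne: "I \<noteq> {}" "J \<noteq> {}"
    and g: "\<And>t. t \<in> J \<Longrightarrow> g t \<in> I"
  shows "distr (\<Pi>\<^sub>M i\<in>I. \<Pi>\<^sub>M t\<in>J. M t) (\<Pi>\<^sub>M t\<in>J. M t) (\<lambda>x. \<lambda>t\<in>J. x (g t) t) = (\<Pi>\<^sub>M t\<in>J. M t)"
    and "(\<lambda>x. \<lambda>t\<in>J. x (g t) t) \<in> (\<Pi>\<^sub>M i\<in>I. \<Pi>\<^sub>M t\<in>J. M t) \<rightarrow>\<^sub>M (\<Pi>\<^sub>M t\<in>J. M t)"
proof -
  let ?M = "\<lambda>p :: 'i \<times> 't. M (snd p)"
  let ?F = "PiM (I \<times> J) ?M" and ?S = "\<Pi>\<^sub>M i\<in>I. PiM J M"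
  let ?c = "\<lambda>f :: 'i \<times> 't \<Rightarrow> 'a. \<lambda>i\<in>I. \<lambda>t\<in>J. f (i, t)"
  have c: "?c \<in> ?F \<rightarrow>\<^sub>M ?S"
  proof (intro measurable_restrict)
    show "(\<lambda>f. f (i, t)) \<in> ?F \<rightarrow>\<^sub>M M t" if "i \<in> I" "t \<in> J" for i t
      using measurable_component_singleton[of "(i, t)" "I \<times> J" ?M] that by simp
  qed
  show pick: "(\<lambda>x. \<lambda>t\<in>J. x (g t) t) \<in> ?S \<rightarrow>\<^sub>M PiM J M"
    using g by (intro measurable_restrict measurable_PiM_PiM_component) auto
  have curry: "distr ?F ?S ?c = ?S"
    by (rule distr_PiM_curry[OF M ne])
  have "distr ?S (PiM J M) (\<lambda>x. \<lambda>t\<in>J. x (g t) t)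
    = distr (distr ?F ?S ?c) (PiM J M) (\<lambda>x. \<lambda>t\<in>J. x (g t) t)"
    by (simp only: curry)
  also have "\<dots> = distr ?F (PiM J M) (\<lambda>f. \<lambda>t\<in>J. f (g t, t))"
    using g by (subst distr_distr[OF pick c]) (simp add: comp_def cong: restrict_cong)
  also have "\<dots> = PiM J M"
    using distr_PiM_reindex[of "I \<times> J" ?M "\<lambda>t. (g t, t)" J] M g by (auto simp: inj_on_def)
  finally show "distr ?S (PiM J M) (\<lambda>x. \<lambda>t\<in>J. x (g t) t) = PiM J M" .
qed

text \<open>The map sending \<open>(i, t)\<close> to \<open>(h t i, t)\<close> is an injection of
  \<open>I \<times> J\<close> into itself, so on the flat product this is again a reindexing.
  Recombined samples use it with \<open>h t\<close> a cyclic shift by an amount depending on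
  \<open>t\<close>.\<close>

lemma distr_PiM_PiM_permute:
  fixes M :: "'t \<Rightarrow> 'a measure" and I :: "'i set" and J :: "'t set"
  assumes M: "\<And>t. t \<in> J \<Longrightarrow> prob_space (M t)" and ne: "I \<noteq> {}" "J \<noteq> {}"
    and h: "\<And>t. t \<in> J \<Longrightarrow> inj_on (h t) I" "\<And>i t. i \<in> I \<Longrightarrow> t \<in> J \<Longrightarrow> h t i \<in> I"
  defines "S \<equiv> \<Pi>\<^sub>M i\<in>I. \<Pi>\<^sub>M t\<in>J. M t"
  shows "distr S S (\<lambda>x. \<lambda>i\<in>I. \<lambda>t\<in>J. x (h t i) t) = S"
    and "(\<lambda>x. \<lambda>i\<in>I. \<lambda>t\<in>J. x (h t i) t) \<in> S \<rightarrow>\<^sub>M S"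
proof -
  let ?M = "\<lambda>p :: 'i \<times> 't. M (snd p)"
  let ?F = "PiM (I \<times> J) ?M"
  let ?c = "\<lambda>f :: 'i \<times> 't \<Rightarrow> 'a. \<lambda>i\<in>I. \<lambda>t\<in>J. f (i, t)"
  let ?r = "\<lambda>f :: 'i \<times> 't \<Rightarrow> 'a. \<lambda>p\<in>I \<times> J. f (h (snd p) (fst p), snd p)"
  have c: "?c \<in> ?F \<rightarrow>\<^sub>M S" unfolding S_def
  proof (intro measurable_restrict)
    show "(\<lambda>f. f (i, t)) \<in> ?F \<rightarrow>\<^sub>M M t" if "i \<in> I" "t \<in> J" for i t
      using measurable_component_singleton[of "(i, t)" "I \<times> J" ?M] that by simp
  qed
  have r: "?r \<in> ?F \<rightarrow>\<^sub>M ?F"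
  proof (rule measurable_restrict)
    show "(\<lambda>f. f (h (snd p) (fst p), snd p)) \<in> ?F \<rightarrow>\<^sub>M ?M p" if "p \<in> I \<times> J" for p
      using measurable_component_singleton[of "(h (snd p) (fst p), snd p)" "I \<times> J" ?M] that h
      by auto
  qed
  show perm: "(\<lambda>x. \<lambda>i\<in>I. \<lambda>t\<in>J. x (h t i) t) \<in> S \<rightarrow>\<^sub>M S" unfolding S_def
    using h by (intro measurable_restrict measurable_PiM_PiM_component) auto
  have curry: "distr ?F S ?c = S"
    unfolding S_def by (rule distr_PiM_curry[OF M ne])
  have "distr S S (\<lambda>x. \<lambda>i\<in>I. \<lambda>t\<in>J. x (h t i) t)
    = distr (distr ?F S ?c) S (\<lambda>x. \<lambda>i\<in>I. \<lambda>t\<in>J. x (h t i) t)"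
    by (simp only: curry)
  also have "\<dots> = distr ?F S (\<lambda>f. \<lambda>i\<in>I. \<lambda>t\<in>J. f (h t i, t))"
    using h by (subst distr_distr[OF perm c]) (simp add: comp_def cong: restrict_cong)
  \<comment> \<open>The relabelling is moved to the flat product: first \<open>?r\<close> relabels,
    then \<open>?c\<close> regroups.\<close>
  also have "\<dots> = distr (distr ?F ?F ?r) S ?c"
    by (subst distr_distr[OF c r]) (simp add: comp_def cong: restrict_cong)
  also have "distr ?F ?F ?r = ?F"
    using distr_PiM_reindex[of "I \<times> J" ?M "\<lambda>p. (h (snd p) (fst p), snd p)" "I \<times> J"] M h
    by (force simp: inj_on_def Pi_iff)
  also note curry
  finally show "distr S S (\<lambda>x. \<lambda>i\<in>I. \<lambda>t\<in>J. x (h t i) t) = S" .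
qed

section \<open>Cyclic shifts and recombined samples\<close>

text \<open>A Latin square on \<open>{1..N}\<close>: symmetric, and a permutation in each argument.\<close>
definition cyc :: "nat \<Rightarrow> nat \<Rightarrow> nat \<Rightarrow> nat" where
  "cyc N k i = (i + k) mod N + 1"

lemma cyc_commute: "cyc N k i = cyc N i k"
  by (simp add: cyc_def add.commute)

lemma cyc_in: "N > 0 \<Longrightarrow> cyc N k i \<in> {1..N}"
  by (simp add: cyc_def Suc_leI)

lemma inj_on_cyc: "inj_on (cyc N k) {1..N}"
proof (rule linorder_inj_onI)
  fix i j assume "i < j" "i \<in> {1..N}" "j \<in> {1..N}"
  \<comment> \<open>\<open>0 < j - i < N\<close>, since both indices lie in
    \<open>{1..N}\<close>.\<close>
  then have "\<not> N dvd (j + k) - (i + k)"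
    by (auto dest!: dvd_imp_le)
  then show "cyc N k i \<noteq> cyc N k j"
    using \<open>i < j\<close> mod_eq_dvd_iff_nat[of "i + k" "j + k" N] by (auto simp: cyc_def)
qed auto

text \<open>Here \<open>i\<close> is fixed and the shifts vary, so injectivity in the other argument
  of the Latin square is used, via \<open>cyc_commute\<close>; an injective self-map of the finite
  set of tuples is onto.\<close>

lemma sum_PiE_cyc:
  fixes f :: "('t \<Rightarrow> nat) \<Rightarrow> real"
  assumes "finite J" "N > 0"
  shows "(\<Sum>k\<in>J \<rightarrow>\<^sub>E {1..N}. f (\<lambda>t\<in>J. cyc N (k t) i)) = (\<Sum>k\<in>J \<rightarrow>\<^sub>E {1..N}. f k)"
proof (rule sum.reindex_bij_betw)
  let ?K = "J \<rightarrow>\<^sub>E {1..N}" and ?g = "\<lambda>k. \<lambda>t\<in>J. cyc N (k t) i"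
  have "inj_on ?g ?K"
  proof (rule inj_onI)
    fix k k' assume k: "k \<in> ?K" "k' \<in> ?K" and eq: "?g k = ?g k'"
    show "k = k'"
    proof (rule PiE_ext[OF k])
      fix t assume "t \<in> J"
      then have "cyc N i (k t) = cyc N i (k' t)"
        using fun_cong[OF eq, of t] by (simp add: cyc_commute)
      then show "k t = k' t"
        by (rule inj_onD[OF inj_on_cyc]) (use k \<open>t \<in> J\<close> in \<open>auto dest: PiE_mem\<close>)
    qed
  qed
  moreover have "?g ` ?K \<subseteq> ?K"
    using cyc_in[OF \<open>N > 0\<close>] by auto
  ultimately show "bij_betw ?g ?K ?K"
    using assms endo_inj_surj[of ?K ?g] by (simp add: bij_betw_def finite_PiE)
qed

text \<open>Column \<open>t\<close> is shifted by \<open>k t + 1\<close> modulo \<open>N\<close>,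
  because of the added 1 in \<open>cyc\<close>; as \<open>k t\<close> runs over
  \<open>{1..N}\<close>, each cyclic shift occurs exactly once. The restrictions keep the result in
  the extensional function space underlying \<open>sample_dist\<close>.\<close>

definition shift_sample ::
  "nat \<Rightarrow> nat \<Rightarrow> (nat \<Rightarrow> nat) \<Rightarrow> (nat \<Rightarrow> demand_seq) \<Rightarrow> nat \<Rightarrow> demand_seq" where
  "shift_sample n N k ds = (\<lambda>i\<in>{1..N}. \<lambda>t\<in>{1..n}. ds (cyc N (k t) i) t)"

text \<open>For fixed \<open>i\<close>, the \<open>i\<close>-th sequence of the shifted sample runs
  through the recombined sequences, once per index tuple, as \<open>k\<close> varies. After
  exchanging the sums, each of the \<open>N\<close> inner sums is thus the full sum, which cancels
  \<open>1 / real N\<close>.\<close>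

lemma product_risk_eq_avg_emp_risk:
  assumes "N > 0"
  shows "product_risk n N l ds \<pi>
    = (1 / real N ^ n) * (\<Sum>k \<in> {1..n} \<rightarrow>\<^sub>E {1..N}. emp_risk N l (shift_sample n N k ds) \<pi>)"
proof -
  let ?K = "{1..n} \<rightarrow>\<^sub>E {1..N}" and ?f = "\<lambda>idx. l \<pi> (product_seq n ds idx)"
  have "(\<Sum>k\<in>?K. emp_risk N l (shift_sample n N k ds) \<pi>)
    = (1 / real N) * (\<Sum>k\<in>?K. \<Sum>i=1..N. ?f (\<lambda>t\<in>{1..n}. cyc N (k t) i))"
    unfolding emp_risk_def sum_distrib_left
    by (simp add: shift_sample_def product_seq_def cong: restrict_cong)
  also have "\<dots> = (1 / real N) * (\<Sum>i=1..N. \<Sum>k\<in>?K. ?f (\<lambda>t\<in>{1..n}. cyc N (k t) i))"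
    by (subst sum.swap) simp
  also have "\<dots> = (\<Sum>k\<in>?K. ?f k)"
    using assms by (subst sum_PiE_cyc) auto
  finally show ?thesis
    by (simp add: product_risk_def)
qed

section \<open>Bounds on averages and suprema\<close>

text \<open>Each summand is at most its own supremum, uniformly in the policy. Nonemptiness and
  \<open>bdd_above\<close> are what suprema in the conditionally complete reals demand.\<close>

lemma cSUP_avg_le:
  fixes f :: "'k \<Rightarrow> 'p \<Rightarrow> real"
  assumes "P \<noteq> {}" "\<And>k. k \<in> K \<Longrightarrow> bdd_above (f k ` P)" "c \<ge> 0"
  shows "(SUP \<pi>\<in>P. c * (\<Sum>k\<in>K. f k \<pi>)) \<le> c * (\<Sum>k\<in>K. SUP \<pi>\<in>P. f k \<pi>)"
  using assms by (intro cSUP_least mult_left_mono sum_mono cSUP_upper) auto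

lemma abs_avg_le:
  fixes f :: "'k \<Rightarrow> real"
  assumes "K \<noteq> {}" "finite K" "\<And>k. k \<in> K \<Longrightarrow> \<bar>f k\<bar> \<le> B"
  shows "\<bar>(1 / real (card K)) * sum f K\<bar> \<le> B"
proof -
  have "\<bar>sum f K\<bar> \<le> (\<Sum>k\<in>K. \<bar>f k\<bar>)"
    by (rule sum_abs)
  also have "\<dots> \<le> real (card K) * B"
    using assms(3) by (rule sum_bounded_above)
  finally show ?thesis
    using assms by (simp add: abs_mult card_gt_0_iff divide_le_eq mult.commute)
qed

theorem mainTheorem9:
  fixes T L N :: nat and U :: real
    and Dt :: "nat \<Rightarrow> real measure"
    and D :: "demand_seq measure"
    and S :: "(nat \<Rightarrow> demand_seq) measure"
    and P :: "'p set"
    and l :: "'p \<Rightarrow> demand_seq \<Rightarrow> real"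
    and \<pi>_opt :: 'p
    and \<pi>_perm :: "(nat \<Rightarrow> demand_seq) \<Rightarrow> 'p"
  assumes "T > 0" and "N > 0" and "U > 0"
    and marginals_prob: "\<And>t. t \<in> {1..T+L} \<Longrightarrow> prob_space (Dt t)"
    and marginals_sets: "\<And>t. t \<in> {1..T+L} \<Longrightarrow> sets (Dt t) = sets (restrict_space borel {0..U})"
    and D_eq: "D = demand_dist (T + L) Dt"
    and S_eq: "S = sample_dist N D"
    and loss_measurable: "\<And>\<pi>. \<pi> \<in> P \<Longrightarrow> l \<pi> \<in> borel_measurable D"
    and loss_bounded: "\<exists>B. \<forall>\<pi>\<in>P. \<forall>d\<in>space D. \<bar>l \<pi> d\<bar> \<le> B"
    and opt: "is_arg_min (risk D l) (\<lambda>\<pi>. \<pi> \<in> P) \<pi>_opt"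
    and perm: "\<And>ds. ds \<in> space S \<Longrightarrow>
      is_arg_min (product_risk (T + L) N l ds) (\<lambda>\<pi>. \<pi> \<in> P) (\<pi>_perm ds)"
    and EE_measurable: "est_error D l \<pi>_perm \<pi>_opt \<in> borel_measurable S"
    and GEx_measurable: "product_gen_error (T + L) N D l P \<in> borel_measurable S"
    and GE_measurable: "gen_error N D l P \<in> borel_measurable S"
  shows "(\<integral>ds. est_error D l \<pi>_perm \<pi>_opt ds \<partial>S)
           \<le> (\<integral>ds. product_gen_error (T + L) N D l P ds \<partial>S)
       \<and> (\<integral>ds. product_gen_error (T + L) N D l P ds \<partial>S)
           \<le> (\<integral>ds. gen_error N D l P ds \<partial>S)"
proof -
  define n where "n = T + L"
  let ?K = "{1..n} \<rightarrow>\<^sub>E {1..N}"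
  have n: "n > 0" and ne: "{1..N} \<noteq> {}" "{1..n} \<noteq> {}"
    using \<open>T > 0\<close> \<open>N > 0\<close> by (auto simp: n_def)
  have marginals: "prob_space (Dt t)" if "t \<in> {1..n}" for t
    using that marginals_prob by (auto simp: n_def)
  have D: "D = (\<Pi>\<^sub>M t\<in>{1..n}. Dt t)" and S: "S = (\<Pi>\<^sub>M i\<in>{1..N}. \<Pi>\<^sub>M t\<in>{1..n}. Dt t)"
    by (simp_all add: D_eq S_eq demand_dist_def sample_dist_def n_def)
  interpret D: prob_space D
    unfolding D using marginals by (rule prob_space_PiM)
  interpret S: prob_space S
    unfolding S by (intro prob_space_PiM marginals)
  have cardK: "card ?K = N ^ n" and finK: "finite ?K" and neK: "?K \<noteq> {}"
    using ne by (auto simp: card_PiE finite_PiE PiE_eq_empty_iff)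

  \<comment> \<open>Laws of recombined sequences and samples\<close>
  have pick: "(\<lambda>ds. product_seq n ds idx) \<in> S \<rightarrow>\<^sub>M D"
      "distr S D (\<lambda>ds. product_seq n ds idx) = D" if "idx \<in> ?K" for idx
    unfolding product_seq_def S D
    by (rule distr_PiM_PiM_pick[OF marginals ne PiE_mem[OF that]]; assumption)+
  \<comment> \<open>This holds for every \<open>k\<close>, also outside \<open>?K\<close>:
    \<open>cyc N (k t)\<close> permutes \<open>{1..N}\<close> for any amount of shift.\<close>
  have shift: "shift_sample n N k \<in> S \<rightarrow>\<^sub>M S" "distr S S (shift_sample n N k) = S" for k
    unfolding shift_sample_def S
    by (rule distr_PiM_PiM_permute[OF marginals ne inj_on_cyc cyc_in[OF \<open>N > 0\<close>]]; assumption)+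

  \<comment> \<open>Boundedness and integrability\<close>
  obtain B where B: "\<bar>l \<pi> d\<bar> \<le> B" if "\<pi> \<in> P" "d \<in> space D" for \<pi> d
    using loss_bounded by blast
  have integrable_loss: "integrable D (l \<pi>)" if "\<pi> \<in> P" for \<pi>
    using B loss_measurable that by (intro D.integrable_const_bound[of _ B]) auto
  have risk_bound: "\<bar>risk D l \<pi>\<bar> \<le> B" if "\<pi> \<in> P" for \<pi>
  proof -
    have "\<bar>risk D l \<pi>\<bar> \<le> (\<integral>d. \<bar>l \<pi> d\<bar> \<partial>D)"
      unfolding risk_def by (rule integral_abs_bound)
    also have "\<dots> \<le> B"
      using B[OF that] integrable_loss[OF that] by (intro D.integral_le_const AE_I2) auto
    finally show ?thesis .
  qed
  have emp_bound: "\<bar>emp_risk N l ds \<pi>\<bar> \<le> B" if "\<pi> \<in> P" "ds \<in> space S" for \<pi> ds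
  proof -
    have "ds i \<in> space D" if "i \<in> {1..N}" for i
      using that \<open>ds \<in> space S\<close> by (auto simp: S D space_PiM PiE_iff)
    then show ?thesis
      using abs_avg_le[of "{1..N}" "\<lambda>i. l \<pi> (ds i)" B] B[OF \<open>\<pi> \<in> P\<close>] ne
      by (simp add: emp_risk_def)
  qed
  have prod_bound: "\<bar>product_risk n N l ds \<pi>\<bar> \<le> B" if "\<pi> \<in> P" "ds \<in> space S" for \<pi> ds
    using abs_avg_le[OF neK finK, of "\<lambda>idx. l \<pi> (product_seq n ds idx)" B]
      B[OF that(1) measurable_space[OF pick(1) that(2)]]
    by (simp add: product_risk_def cardK[simplified])

  have opt_P: "\<pi>_opt \<in> P"
    using opt by (simp add: is_arg_min_def)
  then have P: "P \<noteq> {}"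
    by auto
  have perm_P: "\<pi>_perm ds \<in> P"
    and perm_le: "product_risk n N l ds (\<pi>_perm ds) \<le> product_risk n N l ds \<pi>_opt"
    if "ds \<in> space S" for ds
    using perm[OF that] opt_P by (auto simp: is_arg_min_linorder n_def)

  have emp_diff: "\<bar>risk D l \<pi> - emp_risk N l ds \<pi>\<bar> \<le> 2 * B"
    and prod_diff: "\<bar>risk D l \<pi> - product_risk n N l ds \<pi>\<bar> \<le> 2 * B"
    if "\<pi> \<in> P" "ds \<in> space S" for \<pi> ds
    using risk_bound[OF that(1)] emp_bound[OF that] prod_bound[OF that] by auto
  have emp_bdd: "bdd_above ((\<lambda>\<pi>. risk D l \<pi> - emp_risk N l ds \<pi>) ` P)"
    and prod_bdd: "bdd_above ((\<lambda>\<pi>. risk D l \<pi> - product_risk n N l ds \<pi>) ` P)"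
    if "ds \<in> space S" for ds
    using emp_diff[OF _ that] prod_diff[OF _ that] by (fastforce intro!: bdd_aboveI2[of _ _ "2 * B"])+
  \<comment> \<open>Monotonicity of the integral needs integrability, a non-integrable function
    having integral 0 by convention. The bound \<open>2 * B\<close> passes from the differences to
    their supremum.\<close>
  have GE_int: "integrable S (gen_error N D l P)"
    using GE_measurable P emp_diff
    by (intro S.integrable_const_bound[of _ "2 * B"] AE_I2)
       (auto simp: gen_error_def intro!: cSup_abs_le)
  have GEx_int: "integrable S (product_gen_error n N D l P)"
    using GEx_measurable P prod_diff
    by (intro S.integrable_const_bound[of _ "2 * B"] AE_I2)
       (auto simp: product_gen_error_def n_def intro!: cSup_abs_le)
  have EE_int: "integrable S (est_error D l \<pi>_perm \<pi>_opt)"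
  proof (rule S.integrable_const_bound[of _ "2 * B", OF AE_I2 EE_measurable])
    fix ds assume "ds \<in> space S"
    then show "norm (est_error D l \<pi>_perm \<pi>_opt ds) \<le> 2 * B"
      using risk_bound[OF perm_P] risk_bound[OF opt_P] by (fastforce simp: est_error_def)
  qed

  \<comment> \<open>Estimation error against product generalization error\<close>
  have loss_pick: "(\<integral>ds. l \<pi> (product_seq n ds idx) \<partial>S) = risk D l \<pi>"
      "integrable S (\<lambda>ds. l \<pi> (product_seq n ds idx))"
    if "\<pi> \<in> P" "idx \<in> ?K" for \<pi> idx
  proof -
    show "(\<integral>ds. l \<pi> (product_seq n ds idx) \<partial>S) = risk D l \<pi>"
      using integral_distr[OF pick(1)[OF that(2)] loss_measurable[OF that(1)]]
      by (simp add: pick(2)[OF that(2)] risk_def)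
    show "integrable S (\<lambda>ds. l \<pi> (product_seq n ds idx))"
      using integrable_loss[OF that(1)]
      by (intro integrable_distr[OF pick(1)[OF that(2)]]) (simp add: pick(2)[OF that(2)])
  qed
  have product_risk_int: "integrable S (\<lambda>ds. product_risk n N l ds \<pi>)" if "\<pi> \<in> P" for \<pi>
    using loss_pick(2)[OF that] by (simp add: product_risk_def)
  have product_risk_unbiased: "(\<integral>ds. product_risk n N l ds \<pi> \<partial>S) = risk D l \<pi>" if "\<pi> \<in> P" for \<pi>
    using loss_pick[OF that] \<open>N > 0\<close> by (simp add: product_risk_def cardK[simplified])

  \<comment> \<open>Add and subtract the product risk of \<open>\<pi>_perm ds\<close>: the first
    difference is at most the supremum, and in the second, minimality replaces this product risk by
    that of \<open>\<pi>_opt\<close>.\<close>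
  have "est_error D l \<pi>_perm \<pi>_opt ds
    \<le> product_gen_error n N D l P ds + (product_risk n N l ds \<pi>_opt - risk D l \<pi>_opt)"
    if "ds \<in> space S" for ds
    using cSUP_upper[OF perm_P[OF that] prod_bdd[OF that]] perm_le[OF that]
    by (simp add: est_error_def product_gen_error_def)
  then have "(\<integral>ds. est_error D l \<pi>_perm \<pi>_opt ds \<partial>S)
    \<le> (\<integral>ds. product_gen_error n N D l P ds + (product_risk n N l ds \<pi>_opt - risk D l \<pi>_opt) \<partial>S)"
    using EE_int GEx_int product_risk_int[OF opt_P] by (intro integral_mono) auto
  \<comment> \<open>The correction term has mean zero: \<open>\<pi>_opt\<close> does not depend on
    \<open>ds\<close>, so unbiasedness applies to it.\<close>
  also have "\<dots> = (\<integral>ds. product_gen_error n N D l P ds \<partial>S)"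
    using GEx_int product_risk_int[OF opt_P] product_risk_unbiased[OF opt_P]
    by (simp add: S.prob_space)
  finally have EE_le: "(\<integral>ds. est_error D l \<pi>_perm \<pi>_opt ds \<partial>S)
    \<le> (\<integral>ds. product_gen_error n N D l P ds \<partial>S)" .

  \<comment> \<open>Product generalization error against generalization error\<close>
  have GE_shift: "(\<integral>ds. gen_error N D l P (shift_sample n N k ds) \<partial>S) = (\<integral>ds. gen_error N D l P ds \<partial>S)"
      "integrable S (\<lambda>ds. gen_error N D l P (shift_sample n N k ds))" for k
    using integral_distr[OF shift(1)[of k] GE_measurable]
      integrable_distr[OF shift(1)[of k], of "gen_error N D l P"] GE_int
    by (simp_all add: shift(2))
  have "product_gen_error n N D l P ds
    \<le> (1 / real N ^ n) * (\<Sum>k\<in>?K. gen_error N D l P (shift_sample n N k ds))"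
    if "ds \<in> space S" for ds
  proof -
    \<comment> \<open>The constant risk moves inside the average over the \<open>N ^ n\<close>
      tuples, so that the supremum is taken of a single average.\<close>
    have eq: "risk D l \<pi> - product_risk n N l ds \<pi>
      = (1 / real N ^ n) * (\<Sum>k\<in>?K. risk D l \<pi> - emp_risk N l (shift_sample n N k ds) \<pi>)" for \<pi>
      using \<open>N > 0\<close>
      by (simp add: product_risk_eq_avg_emp_risk sum_subtractf cardK[simplified] diff_divide_distrib)
    show ?thesis
      unfolding product_gen_error_def gen_error_def eq
      using that by (intro cSUP_avg_le P emp_bdd measurable_space[OF shift(1)]) auto
  qed
  then have "(\<integral>ds. product_gen_error n N D l P ds \<partial>S)
    \<le> (\<integral>ds. (1 / real N ^ n) * (\<Sum>k\<in>?K. gen_error N D l P (shift_sample n N k ds)) \<partial>S)"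
    using GEx_int GE_shift(2) by (intro integral_mono) auto
  \<comment> \<open>All \<open>N ^ n\<close> summands have the same integral, since the shifts
    preserve \<open>S\<close>.\<close>
  also have "\<dots> = (\<integral>ds. gen_error N D l P ds \<partial>S)"
    using GE_shift \<open>N > 0\<close> by (simp add: cardK[simplified])
  finally show ?thesis
    using EE_le by (simp add: n_def)
qed

end
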